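(* Let $K\ge 2$ be an integer, let $\mathcal{U}=\{a_1,\dots,a_K\}$ be a set of $K$ distinct candidates, of which $a_1$ is the correct one (without loss of generality), and put $\ell(c):=\log\frac{c(K-1)}{1-c}$ for $c\in(0,1)$. Let $(R_t,C_t)$, $t\ge 1$, be i.i.d. samples from an arbitrary joint distribution over $\mathcal{U}\times(0,1)$ with $\mathbb{E}[|\ell(C_t)|]<\infty$. For $m\ge 1$ and $i\in[K]$ let $$X_i=X_i^{(m)}:=\frac{s_i^{(m)}}{\sum_{j=1}^K s_j^{(m)}},\qquad s_i^{(m)}:=\prod_{t\le m:\,R_t=a_i}C_t\;\prod_{t\le m:\,R_t\ne a_i}\frac{1-C_t}{K-1}.$$ For each $k\ne 1$ define $$\mu_k:=\mathbb{E}\left[\bigl(\mathbf{1}\{R_t=a_1\}-\mathbf{1}\{R_t=a_k\}\bigr)\,\ell(C_t)\right],$$ where the expectation is over the true joint distribution of $(R_t,C_t)$. If $\mu_k>0$ for every $k\ne 1$, then, as $m\to\infty$, $X_1^{(m)}\to 1$ almost surely and $X_k^{(m)}\to 0$ almost surely for all $k\ne 1$. Conversely, if $\mu_{k^\star}<0$ for some $k^\star\ne 1$, then $X_1^{(m)}\to 0$ almost surely as $m\to\infty$.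
   Context: $R_t$ is the answer returned at the $t$-th sample and $C_t$ its confidence score, which may depend arbitrarily on $R_t$ and need not be calibrated. $X_i^{(m)}$ is a normalized scoring rule computed from the first $m$ samples; it is not assumed to equal a true posterior probability. *)

theory Defs
  imports "HOL-Probability.Probability"
begin

definition ell :: "nat \<Rightarrow> real \<Rightarrow> real" where
  "ell K c = ln (c * (real K - 1) / (1 - c))"

text \<open>A sample is a pair of an answer in \<open>U\<close> and a confidence in the open unit interval; \<open>U\<close>
  carries the discrete sigma-algebra, so a random variable with values in this space lies in
  \<open>U \<times> (0,1)\<close> everywhere, and nothing is assumed about the dependence of the two components.\<close>

definition sample_space :: "'a set \<Rightarrow> ('a \<times> real) measure" where
  "sample_space U = count_space U \<Otimes>\<^sub>M restrict_space borel {0<..<1}"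

text \<open>Independent samples, indexed from 1, with common joint law \<open>D\<close> on \<open>sample_space U\<close>.\<close>

definition iid_samples ::
  "'w measure \<Rightarrow> 'a set \<Rightarrow> ('a \<times> real) measure \<Rightarrow> (nat \<Rightarrow> 'w \<Rightarrow> 'a) \<Rightarrow> (nat \<Rightarrow> 'w \<Rightarrow> real) \<Rightarrow> bool" where
  "iid_samples M U D R C \<longleftrightarrow>
     prob_space.indep_vars M (\<lambda>_. sample_space U) (\<lambda>t \<omega>. (R t \<omega>, C t \<omega>)) {1..} \<and>
     (\<forall>t\<ge>1. distr M (sample_space U) (\<lambda>\<omega>. (R t \<omega>, C t \<omega>)) = D)"

text \<open>The next two definitions take one realisation \<open>r\<close>, \<open>c\<close> of the sample sequence.\<close>

definition score :: "nat \<Rightarrow> (nat \<Rightarrow> 'a) \<Rightarrow> (nat \<Rightarrow> real) \<Rightarrow> nat \<Rightarrow> 'a \<Rightarrow> real" where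
  "score K r c m x =
     (\<Prod>t | t \<in> {1..m} \<and> r t = x. c t) *
     (\<Prod>t | t \<in> {1..m} \<and> r t \<noteq> x. (1 - c t) / (real K - 1))"

definition normalized_score ::
  "nat \<Rightarrow> (nat \<Rightarrow> 'a) \<Rightarrow> (nat \<Rightarrow> 'a) \<Rightarrow> (nat \<Rightarrow> real) \<Rightarrow> nat \<Rightarrow> nat \<Rightarrow> real" where
  "normalized_score K a r c m i = score K r c m (a i) / (\<Sum>j=1..K. score K r c m (a j))"

definition drift :: "nat \<Rightarrow> (nat \<Rightarrow> 'a) \<Rightarrow> ('a \<times> real) measure \<Rightarrow> nat \<Rightarrow> real" where
  "drift K a D k = (LINT (r, c)|D. (of_bool (r = a 1) - of_bool (r = a k)) * ell K c)"

end

theory Submission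
  imports Defs
begin

text \<open>
  The ratio of the scores of two candidates is the exponential of an i.i.d. sum, so no limiting
  average is needed: it suffices that an i.i.d. sum with positive mean tends to infinity almost
  surely. For this let \<open>F n\<close> be the maximum of \<open>0\<close> and the first \<open>n\<close> partial sums of an i.i.d. sequence
  with negative mean, and \<open>A\<close> the shift-invariant event that \<open>F n\<close> is unbounded. Prepending an
  independent term \<open>Z\<close> gives \<open>F (n + 1) = max 0 (Z + F n)\<close> and preserves the law of the sequence, so
  monotonicity of \<open>F\<close> yields \<open>0 \<le> E[1\<^sub>A * max (- F n) Z]\<close>, which tends to \<open>P(A) * E[Z]\<close> by dominated
  convergence. Hence \<open>A\<close> is a null set. Subtracting half of the mean turns this boundedness
  into divergence.
\<close>

section \<open>Running maxima of partial sums along a fixed sequence\<close>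

primrec max_sum :: "nat \<Rightarrow> (nat \<Rightarrow> real) \<Rightarrow> real" where
  "max_sum 0 z = 0"
| "max_sum (Suc n) z = max 0 (z 0 + max_sum n (\<lambda>i. z (Suc i)))"

lemma max_sum_nonneg: "0 \<le> max_sum n z"
  by (cases n) auto

lemma max_sum_mono: "max_sum n z \<le> max_sum (Suc n) z"
proof (induction n arbitrary: z)
  case (Suc n)
  show ?case
    using Suc.IH[of "\<lambda>i. z (Suc i)"] by (subst (1 2) max_sum.simps) (auto simp del: max_sum.simps)
qed simp

lemma sum_le_max_sum: "(\<Sum>i<n. z i) \<le> max_sum n z"
proof (induction n arbitrary: z)
  case (Suc n)
  show ?case
    using Suc.IH[of "\<lambda>i. z (Suc i)"] by (simp add: sum.lessThan_Suc_shift del: sum.lessThan_Suc)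
qed simp

text \<open>Putting \<open>z 0\<close> in front moves the running maximum by a fixed amount, up to
  truncation at 0, and this cannot affect unboundedness.\<close>

lemma max_sum_unbounded_shift:
  "(\<forall>B. \<exists>n. max_sum n z > B) \<longleftrightarrow> (\<forall>B. \<exists>n. max_sum n (\<lambda>i. z (Suc i)) > B)"
proof safe
  fix B assume "\<forall>B. \<exists>n. max_sum n z > B"
  \<comment> \<open>The 0 in the threshold excludes \<open>n = 0\<close> and the truncated case; the
    term \<open>z 0 + B\<close> then leaves more than \<open>B\<close> for the remaining
    sequence.\<close>
  then obtain n where n: "max_sum n z > max 0 (z 0 + B)" by blast
  then obtain k where "n = Suc k" by (cases n) auto
  with n show "\<exists>n. max_sum n (\<lambda>i. z (Suc i)) > B"
    by (intro exI[of _ k]) (auto simp: max_def split: if_splits)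
next
  fix B assume "\<forall>B. \<exists>n. max_sum n (\<lambda>i. z (Suc i)) > B"
  then obtain n where n: "max_sum n (\<lambda>i. z (Suc i)) > B - z 0" by blast
  then show "\<exists>n. max_sum n z > B"
    by (intro exI[of _ "Suc n"]) auto
qed

lemma max_sum_at_top:
  assumes "\<forall>B. \<exists>n. max_sum n z > B"
  shows "filterlim (\<lambda>n. max_sum n z) at_top sequentially"
  unfolding filterlim_at_top
proof
  fix B
  obtain n where "max_sum n z > B" using assms by blast
  moreover have "incseq (\<lambda>n. max_sum n z)" by (intro incseq_SucI max_sum_mono)
  ultimately show "eventually (\<lambda>n. B \<le> max_sum n z) sequentially"
    unfolding eventually_sequentially by (meson incseqD less_le_trans less_imp_le)
qed

section \<open>Sums of i.i.d. variables, first on the product space of sequences\<close>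

context sequence_space
begin

lemma measurable_shift: "(\<lambda>\<omega> i. \<omega> (Suc i)) \<in> measurable S S"
  by (intro measurable_PiM_single') (auto simp: space_PiM)

lemma measurable_max_sum:
  assumes [measurable]: "g \<in> borel_measurable M"
  shows "(\<lambda>\<omega>. max_sum n (\<lambda>i. g (\<omega> i))) \<in> borel_measurable S"
proof (induction n)
  case (Suc n)
  note [measurable] = measurable_compose[OF measurable_shift Suc]
  show ?case by simp
qed simp

lemma distr_fst: "distr (M \<Otimes>\<^sub>M S) M fst = M"
  by (metis P.prob_space_axioms prob_space.distr_pair_fst)

lemma distr_snd: "distr (M \<Otimes>\<^sub>M S) S snd = S"
proof (rule measure_eqI)
  fix A assume "A \<in> sets (distr (M \<Otimes>\<^sub>M S) S snd)"
  then have A: "A \<in> sets S" by simp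
  have "snd -` A \<inter> space (M \<Otimes>\<^sub>M S) = space M \<times> A"
    using sets.sets_into_space[OF A] by (auto simp: space_pair_measure)
  with A show "emeasure (distr (M \<Otimes>\<^sub>M S) S snd) A = emeasure S A"
    by (simp add: emeasure_distr P.emeasure_pair_measure_Times M.emeasure_space_1)
qed simp

lemma integrable_comp_fst:
  fixes g :: "'a \<Rightarrow> real"
  assumes "integrable M g"
  shows "integrable (M \<Otimes>\<^sub>M S) (\<lambda>x. g (fst x))"
  using assms by (intro integrable_distr[of fst _ M]) (auto simp: distr_fst)

lemma integrable_comp_snd:
  fixes f :: "(nat \<Rightarrow> 'a) \<Rightarrow> real"
  assumes "integrable S f"
  shows "integrable (M \<Otimes>\<^sub>M S) (\<lambda>x. f (snd x))"
  using assms by (intro integrable_distr[of snd _ S]) (auto simp: distr_snd)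

lemma integral_comp_snd:
  fixes f :: "(nat \<Rightarrow> 'a) \<Rightarrow> real"
  assumes [measurable]: "f \<in> borel_measurable S"
  shows "(\<integral>x. f (snd x) \<partial>(M \<Otimes>\<^sub>M S)) = (\<integral>\<omega>. f \<omega> \<partial>S)"
  using integral_distr[of snd "M \<Otimes>\<^sub>M S" S f] by (simp add: distr_snd)

lemma measurable_case_nat_pair:
  "(\<lambda>(s, \<omega>). case_nat s \<omega>) \<in> measurable (M \<Otimes>\<^sub>M S) S"
  by measurable

text \<open>By \<open>PiM_iter\<close>, \<open>S\<close> is the image of
  \<open>M \<Otimes>\<^sub>M S\<close> under prepending a coordinate. This lemma and the next use
  that invariance to move integrals between the two spaces.\<close>

lemma integrable_case_nat_iff:
  fixes f :: "(nat \<Rightarrow> 'a) \<Rightarrow> real"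
  assumes [measurable]: "f \<in> borel_measurable S"
  shows "integrable S f \<longleftrightarrow> integrable (M \<Otimes>\<^sub>M S) (\<lambda>x. f (case_nat (fst x) (snd x)))"
  using integrable_distr_eq[OF measurable_case_nat_pair, of f]
  unfolding PiM_iter by (simp add: split_beta')

lemma integral_case_nat:
  fixes f :: "(nat \<Rightarrow> 'a) \<Rightarrow> real"
  assumes [measurable]: "f \<in> borel_measurable S"
  shows "(\<integral>\<omega>. f \<omega> \<partial>S) = (\<integral>x. f (case_nat (fst x) (snd x)) \<partial>(M \<Otimes>\<^sub>M S))"
  using integral_distr[OF measurable_case_nat_pair, of f]
  unfolding PiM_iter by (simp add: split_beta')

lemma integrable_max_sum:
  assumes g: "integrable M g"
  shows "integrable S (\<lambda>\<omega>. max_sum n (\<lambda>i. g (\<omega> i)))"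
proof (induction n)
  case (Suc n)
  note [measurable] = borel_measurable_integrable[OF g]
  show ?case
    by (subst integrable_case_nat_iff[OF measurable_max_sum])
      (auto intro!: integrable_max Bochner_Integration.integrable_add integrable_comp_fst[OF g]
        integrable_comp_snd[OF Suc])
qed simp

lemma AE_max_sum_bounded:
  assumes g: "integrable M g" and neg: "(\<integral>x. g x \<partial>M) < 0"
  shows "AE \<omega> in S. \<exists>B. \<forall>n. max_sum n (\<lambda>i. g (\<omega> i)) \<le> B"
proof -
  note [measurable] = borel_measurable_integrable[OF g]
  define F where "F n \<omega> = max_sum n (\<lambda>i. g (\<omega> i))" for n \<omega>
  have F[measurable]: "F n \<in> borel_measurable S" for n
    unfolding F_def by (rule measurable_max_sum) simp
  have intF: "integrable S (F n)" for n
    unfolding F_def by (rule integrable_max_sum[OF g])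
  \<comment> \<open>Thresholds in \<open>nat\<close> make this a countable combination of measurable
    sets; \<open>A_iff\<close> recovers real thresholds by the Archimedean property.\<close>
  define A where "A = {\<omega> \<in> space S. \<forall>B::nat. \<exists>n. F n \<omega> > B}"
  have [measurable]: "A \<in> sets S"
    unfolding A_def by measurable
  have A_iff: "\<omega> \<in> A \<longleftrightarrow> \<omega> \<in> space S \<and> (\<forall>B. \<exists>n. F n \<omega> > B)" for \<omega>
    unfolding A_def mem_Collect_eq by (meson less_trans reals_Archimedean2)
  have A_shift: "case_nat s \<omega> \<in> A \<longleftrightarrow> \<omega> \<in> A"
    if "s \<in> space M" "\<omega> \<in> space S" for s \<omega>
    using that max_sum_unbounded_shift[of "\<lambda>i. g (case_nat s \<omega> i)"]
    by (auto simp: A_iff F_def space_PiM PiE_iff split: nat.split)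
  have intA: "integrable S (\<lambda>\<omega>. indicator A \<omega> * F n \<omega>)" for n
    using integrable_mult_indicator[OF \<open>A \<in> sets S\<close> intF[of n]] by simp
  \<comment> \<open>With \<open>Z = g (fst x)\<close>, this is the increment on \<open>A\<close>
    caused by prepending: \<open>max 0 (Z + F n) - F n = max (- F n) Z\<close>.\<close>
  define h where "h n x = indicator A (snd x) * max (- F n (snd x)) (g (fst x))" for n x
  have h_nonneg: "0 \<le> (\<integral>x. h n x \<partial>(M \<Otimes>\<^sub>M S))" for n
  proof -
    let ?u = "\<lambda>x. indicator A (snd x) * F n (snd x)"
    let ?v = "\<lambda>x. indicator A (case_nat (fst x) (snd x)) * F (Suc n) (case_nat (fst x) (snd x))"
    have u: "integrable (M \<Otimes>\<^sub>M S) ?u"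
      by (rule integrable_comp_snd[OF intA])
    have v: "integrable (M \<Otimes>\<^sub>M S) ?v"
      using intA[of "Suc n"] by (subst (asm) integrable_case_nat_iff) auto
    have "(\<integral>x. ?u x \<partial>(M \<Otimes>\<^sub>M S)) = (\<integral>\<omega>. indicator A \<omega> * F n \<omega> \<partial>S)"
      by (rule integral_comp_snd) simp
    \<comment> \<open>The comparison is made on \<open>S\<close>, where \<open>F n\<close> is at
      most \<open>F (Suc n)\<close> at the same sequence. Between \<open>snd x\<close> and its
      prolongation by \<open>fst x\<close> it can fail pointwise, when the prepended term is
      negative; only the integrals are ordered.\<close>
    also have "\<dots> \<le> (\<integral>\<omega>. indicator A \<omega> * F (Suc n) \<omega> \<partial>S)"
      by (intro integral_mono intA mult_left_mono) (auto simp: F_def max_sum_mono simp del: max_sum.simps)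
    also have "\<dots> = (\<integral>x. ?v x \<partial>(M \<Otimes>\<^sub>M S))"
      by (rule integral_case_nat) simp
    finally have "0 \<le> (\<integral>x. ?v x - ?u x \<partial>(M \<Otimes>\<^sub>M S))"
      using u v by simp
    also have "\<dots> = (\<integral>x. h n x \<partial>(M \<Otimes>\<^sub>M S))"
      by (intro Bochner_Integration.integral_cong refl)
        (auto simp: h_def space_pair_measure A_shift F_def indicator_def max_def split: if_splits)
    finally show ?thesis .
  qed
  have h_lim: "(\<lambda>n. \<integral>x. h n x \<partial>(M \<Otimes>\<^sub>M S)) \<longlonglongrightarrow> (\<integral>x. indicator A (snd x) * g (fst x) \<partial>(M \<Otimes>\<^sub>M S))"
  \<comment> \<open>Since \<open>F n\<close> is nonnegative, \<open>max (- F n) Z\<close> lies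
    between \<open>Z\<close> and \<open>max 0 Z\<close>, so one bound serves all
    \<open>n\<close>.\<close>
  proof (rule integral_dominated_convergence[where w = "\<lambda>x. \<bar>g (fst x)\<bar>"])
    show "AE x in M \<Otimes>\<^sub>M S. (\<lambda>n. h n x) \<longlonglongrightarrow> indicator A (snd x) * g (fst x)"
    proof (rule AE_I2)
      fix x assume "x \<in> space (M \<Otimes>\<^sub>M S)"
      show "(\<lambda>n. h n x) \<longlonglongrightarrow> indicator A (snd x) * g (fst x)"
      proof (cases "snd x \<in> A")
        case True
        \<comment> \<open>On \<open>A\<close> the monotone \<open>F n\<close> diverges, so
          \<open>- F n\<close> finally drops below \<open>g (fst x)\<close> and \<open>h n x\<close>
          becomes constant in \<open>n\<close>.\<close>
        then have "filterlim (\<lambda>n. F n (snd x)) at_top sequentially"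
          unfolding A_iff F_def by (intro max_sum_at_top) auto
        then have "eventually (\<lambda>n. - g (fst x) \<le> F n (snd x)) sequentially"
          by (auto simp: filterlim_at_top)
        then have "eventually (\<lambda>n. h n x = indicator A (snd x) * g (fst x)) sequentially"
          by eventually_elim (auto simp: h_def max_def)
        then show ?thesis by (rule tendsto_eventually)
      qed (simp add: h_def)
    qed
    show "AE x in M \<Otimes>\<^sub>M S. norm (h n x) \<le> \<bar>g (fst x)\<bar>" for n
    proof (rule AE_I2)
      fix x
      show "norm (h n x) \<le> \<bar>g (fst x)\<bar>"
        using max_sum_nonneg[of n "\<lambda>i. g (snd x i)"]
        by (auto simp: h_def indicator_def F_def max_def)
    qed
    show "integrable (M \<Otimes>\<^sub>M S) (\<lambda>x. \<bar>g (fst x)\<bar>)"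
      by (intro integrable_abs integrable_comp_fst g)
  qed (auto simp: h_def[abs_def])
  interpret MS: pair_sigma_finite M S ..
  have "integrable (M \<Otimes>\<^sub>M S) (\<lambda>x. indicator A (snd x) * g (fst x))"
    by (rule Bochner_Integration.integrable_bound[OF integrable_comp_fst[OF g]])
      (auto simp: indicator_def)
  \<comment> \<open>The event depends on \<open>snd x\<close> and the term on \<open>fst x\<close>,
    so Fubini factors the limit into the probability of \<open>A\<close> and the mean of
    \<open>g\<close>.\<close>
  then have "(\<integral>x. indicator A (snd x) * g (fst x) \<partial>(M \<Otimes>\<^sub>M S)) = (\<integral>s. \<integral>\<omega>. indicator A \<omega> * g s \<partial>S \<partial>M)"
    by (subst MS.integral_fst'[symmetric]) auto
  also have "\<dots> = measure S A * (\<integral>s. g s \<partial>M)"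
    by simp
  finally have "0 \<le> measure S A * (\<integral>s. g s \<partial>M)"
    using LIMSEQ_le_const[OF h_lim] h_nonneg by auto
  then have "measure S A = 0"
    using neg measure_nonneg[of S A] by (metis zero_le_mult_iff not_le order_antisym)
  then have "AE \<omega> in S. \<omega> \<notin> A"
    by (intro AE_not_in) (auto simp: null_sets_def P.emeasure_eq_measure)
  with AE_space show ?thesis
    by eventually_elim (auto simp: A_iff F_def not_less)
qed

lemma AE_sum_at_top:
  assumes g: "integrable M g" and pos: "(\<integral>x. g x \<partial>M) > (0::real)"
  shows "AE \<omega> in S. filterlim (\<lambda>n. \<Sum>i<n. g (\<omega> i)) at_top sequentially"
proof -
  define e where "e = (\<integral>x. g x \<partial>M) / 2"
  have "e > 0" using pos by (simp add: e_def)
  \<comment> \<open>The mean of \<open>g\<close> is \<open>2 * e\<close>, so these terms have mean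
    \<open>- e < 0\<close>; a bound \<open>B\<close> then leaves linear growth
    \<open>n * e - B\<close> for the sums of \<open>g\<close>.\<close>
  have "AE \<omega> in S. \<exists>B. \<forall>n. max_sum n (\<lambda>i. e - g (\<omega> i)) \<le> B"
    using g pos by (intro AE_max_sum_bounded) (auto simp: e_def M.prob_space)
  then show ?thesis
  proof eventually_elim
    case (elim \<omega>)
    then obtain B where B: "max_sum n (\<lambda>i. e - g (\<omega> i)) \<le> B" for n
      by blast
    have "real n * e - B \<le> (\<Sum>i<n. g (\<omega> i))" for n
      using order_trans[OF sum_le_max_sum B, of n] by (simp add: sum_subtractf)
    moreover have "filterlim (\<lambda>n. - B + e * real n) at_top sequentially"
      by (intro filterlim_tendsto_add_at_top[OF tendsto_const]
        filterlim_tendsto_pos_mult_at_top[OF tendsto_const \<open>e > 0\<close>] filterlim_real_sequentially)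
    ultimately show ?case
      by (elim filterlim_at_top_mono) (simp add: mult.commute)
  qed
qed

end

text \<open>The sequence of samples has the infinite product of \<open>D\<close> as its law, so the
  almost sure statement on sequence space pulls back to \<open>M\<close>.\<close>

lemma (in prob_space) AE_iid_sum_at_top:
  assumes indep: "indep_vars (\<lambda>_. N) Y {1::nat..}"
    and law: "\<And>t. t \<ge> 1 \<Longrightarrow> distr M N (Y t) = D"
    and g: "integrable D g" and pos: "(\<integral>x. g x \<partial>D) > (0::real)"
  shows "AE \<omega> in M. filterlim (\<lambda>n. \<Sum>t=1..n. g (Y t \<omega>)) at_top sequentially"
proof -
  have Y[measurable]: "Y t \<in> measurable M N" if "t \<ge> 1" for t
    using indep that by (auto simp: indep_vars_def)
  have sets_D: "sets D = sets N"
    using law[of 1] by (metis order_refl sets_distr)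
  have prob_D: "prob_space D"
    using law[of 1] prob_space_distr[OF Y[of 1]] by simp
  then interpret D: prob_space D .
  interpret D: sequence_space D ..
  \<comment> \<open>Samples are indexed from 1 and sequences from 0; the injective reindexing by
    \<open>Suc\<close> carries the product over \<open>{1..}\<close> to the one over all
    naturals.\<close>
  let ?Y = "\<lambda>\<omega> i. Y (Suc i) \<omega>"
  have YD: "?Y \<in> measurable M (\<Pi>\<^sub>M i\<in>UNIV. D)"
    by (intro measurable_PiM_single') (auto simp: measurable_cong_sets[OF refl sets_D] sets_eq_imp_space_eq[OF sets_D]
       intro: measurable_space[OF Y])
  have "(\<Pi>\<^sub>M i\<in>{1..}. D) = (\<Pi>\<^sub>M i\<in>{1..}. distr M N (Y i))"
    using law by (intro PiM_cong) auto
  also have "\<dots> = distr M (\<Pi>\<^sub>M i\<in>{1..}. N) (\<lambda>\<omega>. \<lambda>t\<in>{1..}. Y t \<omega>)"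
    using indep Y by (subst (asm) indep_vars_iff_distr_eq_PiM') auto
  finally have joint: "(\<Pi>\<^sub>M i\<in>{1..}. D) = distr M (\<Pi>\<^sub>M i\<in>{1..}. N) (\<lambda>\<omega>. \<lambda>t\<in>{1..}. Y t \<omega>)" .
  have "(\<Pi>\<^sub>M i\<in>UNIV. D) = distr (\<Pi>\<^sub>M i\<in>{1..}. D) (\<Pi>\<^sub>M i\<in>UNIV. D) (\<lambda>z. \<lambda>i\<in>UNIV. z (Suc i))"
    by (subst distr_PiM_reindex) (auto simp: prob_D)
  also have "\<dots> = distr M (\<Pi>\<^sub>M i\<in>UNIV. D) ((\<lambda>z. \<lambda>i\<in>UNIV. z (Suc i)) \<circ> (\<lambda>\<omega>. \<lambda>t\<in>{1..}. Y t \<omega>))"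
    unfolding joint
  proof (rule distr_distr)
    show "(\<lambda>z. \<lambda>i\<in>UNIV. z (Suc i)) \<in> (\<Pi>\<^sub>M i\<in>{1..}. N) \<rightarrow>\<^sub>M (\<Pi>\<^sub>M i\<in>UNIV. D)"
      by (intro measurable_restrict)
        (simp add: measurable_cong_sets[OF refl sets_D] measurable_component_singleton)
    show "(\<lambda>\<omega>. \<lambda>t\<in>{1..}. Y t \<omega>) \<in> M \<rightarrow>\<^sub>M (\<Pi>\<^sub>M i\<in>{1..}. N)"
      by (intro measurable_restrict) (simp add: Y)
  qed
  also have "\<dots> = distr M (\<Pi>\<^sub>M i\<in>UNIV. D) ?Y"
    by (intro arg_cong[where f = "distr M _"]) (simp add: fun_eq_iff)
  finally have eq: "distr M (\<Pi>\<^sub>M i\<in>UNIV. D) ?Y = (\<Pi>\<^sub>M i\<in>UNIV. D)" ..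
  have "AE z in distr M (\<Pi>\<^sub>M i\<in>UNIV. D) ?Y. filterlim (\<lambda>n. \<Sum>i<n. g (z i)) at_top sequentially"
    unfolding eq by (rule D.AE_sum_at_top[OF g pos])
  from AE_distrD[OF YD this] have "AE \<omega> in M. filterlim (\<lambda>n. \<Sum>i<n. g (?Y \<omega> i)) at_top sequentially" .
  then show ?thesis
    by eventually_elim (simp add: sum.atLeast1_atMost_eq)
qed

section \<open>Scores of one realisation and their ratios\<close>

lemma score_eq_prod:
  "score K r c m x = (\<Prod>t=1..m. if r t = x then c t else (1 - c t) / (real K - 1))"
  unfolding score_def by (subst prod.If_cases) (auto simp: Int_def)

lemma score_pos:
  assumes "K \<ge> 2" "\<forall>t\<ge>1. c t \<in> {0<..<1}"
  shows "score K r c m x > 0"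
  unfolding score_eq_prod using assms by (intro prod_pos) auto

lemma exp_ell:
  assumes "K \<ge> 2" "c \<in> {0<..<1}"
  shows "exp (ell K c) = c / ((1 - c) / (real K - 1))"
  using assms by (simp add: ell_def)

text \<open>Samples answering neither \<open>x\<close> nor \<open>y\<close> cancel. An answer
  \<open>y\<close> contributes the factor \<open>exp (ell K (c t))\<close>, an answer
  \<open>x\<close> its inverse.\<close>

lemma score_ratio:
  assumes "K \<ge> 2" "\<forall>t\<ge>1. c t \<in> {0<..<1}" "x \<noteq> y"
  shows "score K r c m y / score K r c m x =
    exp (- (\<Sum>t=1..m. (of_bool (r t = x) - of_bool (r t = y)) * ell K (c t)))"
proof -
  have "(if r t = y then c t else (1 - c t) / (real K - 1)) / (if r t = x then c t else (1 - c t) / (real K - 1)) =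
      exp (- ((of_bool (r t = x) - of_bool (r t = y)) * ell K (c t)))" if "t \<ge> 1" for t
    using assms that exp_ell[of K "c t"]
    by (auto simp: exp_minus)
  then show ?thesis
    unfolding score_eq_prod prod_dividef[symmetric] sum_negf[symmetric] exp_sum[OF finite_atLeastAtMost]
    by (intro prod.cong) auto
qed

text \<open>The normalising sum has positive terms and includes the score of \<open>a j\<close>.
  Hence a single dominating competitor forces a normalized score to 0, whichever candidate finally
  leads.\<close>

lemma normalized_score_bounds:
  assumes "K \<ge> 2" "\<forall>t\<ge>1. c t \<in> {0<..<1}" "j \<in> {1..K}"
  shows "0 \<le> normalized_score K a r c m i"
    "normalized_score K a r c m i \<le> score K r c m (a i) / score K r c m (a j)"
proof -
  note pos = score_pos[OF assms(1,2)]
  have le: "score K r c m (a j) \<le> (\<Sum>j=1..K. score K r c m (a j))"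
    using assms(3) by (intro member_le_sum) (auto intro: less_imp_le pos)
  show "normalized_score K a r c m i \<le> score K r c m (a i) / score K r c m (a j)"
    unfolding normalized_score_def
    by (intro divide_left_mono mult_pos_pos less_imp_le[OF pos] less_le_trans[OF pos le] le pos)
  show "0 \<le> normalized_score K a r c m i"
    unfolding normalized_score_def by (intro divide_nonneg_nonneg sum_nonneg less_imp_le pos)
qed

lemma sum_normalized_score:
  assumes "K \<ge> 2" "\<forall>t\<ge>1. c t \<in> {0<..<1}"
  shows "(\<Sum>i=1..K. normalized_score K a r c m i) = 1"
proof -
  have "(\<Sum>j=1..K. score K r c m (a j)) > 0"
    using assms(1) by (intro sum_pos score_pos assms) auto
  then show ?thesis
    unfolding normalized_score_def sum_divide_distrib[symmetric] by simp
qed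

lemma normalized_score_tendsto_0:
  assumes "K \<ge> 2" "\<forall>t\<ge>1. c t \<in> {0<..<1}" "j \<in> {1..K}" "a j \<noteq> a i"
    and lim: "filterlim (\<lambda>m. \<Sum>t=1..m. (of_bool (r t = a j) - of_bool (r t = a i)) * ell K (c t)) at_top sequentially"
  shows "(\<lambda>m. normalized_score K a r c m i) \<longlonglongrightarrow> 0"
proof (rule tendsto_sandwich[OF _ _ tendsto_const])
  show "(\<lambda>m. score K r c m (a i) / score K r c m (a j)) \<longlonglongrightarrow> 0"
    unfolding score_ratio[OF assms(1,2,4)]
    by (rule filterlim_compose[OF exp_at_bot iffD1[OF filterlim_uminus_at_top lim]])
qed (simp_all only: normalized_score_bounds[OF assms(1-3)] eventually_True)

theorem theorem3p5:
  fixes K :: nat and a :: "nat \<Rightarrow> 'a" and M :: "'w measure"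
    and R :: "nat \<Rightarrow> 'w \<Rightarrow> 'a" and C :: "nat \<Rightarrow> 'w \<Rightarrow> real" and D :: "('a \<times> real) measure"
  assumes "K \<ge> 2"
    and "inj_on a {1..K}"
    and "prob_space M"
    and "iid_samples M (a ` {1..K}) D R C"
    and "integrable D (\<lambda>(r, c). \<bar>ell K c\<bar>)"
  defines "X \<equiv> \<lambda>i m \<omega>. normalized_score K a (\<lambda>t. R t \<omega>) (\<lambda>t. C t \<omega>) m i"
  shows "((\<forall>k\<in>{1..K} - {1}. drift K a D k > 0) \<longrightarrow>
            (AE \<omega> in M. (\<lambda>m. X 1 m \<omega>) \<longlonglongrightarrow> 1) \<and>
            (\<forall>k\<in>{1..K} - {1}. AE \<omega> in M. (\<lambda>m. X k m \<omega>) \<longlonglongrightarrow> 0)) \<and>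
         ((\<exists>k\<in>{1..K} - {1}. drift K a D k < 0) \<longrightarrow>
            (AE \<omega> in M. (\<lambda>m. X 1 m \<omega>) \<longlonglongrightarrow> 0))"
proof -
  interpret prob_space M by fact
  define U where "U = a ` {1..K}"
  \<comment> \<open>Keeping both candidates as parameters lets one argument serve both directions:
    the converse exchanges the roles of \<open>a 1\<close> and \<open>a k\<close>.\<close>
  define g where "g = (\<lambda>(x::'a) y (r, c). (of_bool (r = x) - of_bool (r = y)) * ell K c)"
  have indep: "indep_vars (\<lambda>_. sample_space U) (\<lambda>t \<omega>. (R t \<omega>, C t \<omega>)) {1..}"
    and law: "\<And>t. t \<ge> 1 \<Longrightarrow> distr M (sample_space U) (\<lambda>\<omega>. (R t \<omega>, C t \<omega>)) = D"
    using assms(4) by (auto simp: iid_samples_def U_def)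
  have sets_D: "sets D = sets (sample_space U)"
    using law[of 1] by (metis order_refl sets_distr)
  have C: "C t \<omega> \<in> {0<..<1}" if "t \<ge> 1" "\<omega> \<in> space M" for t \<omega>
  proof -
    have "(\<lambda>\<omega>. (R t \<omega>, C t \<omega>)) \<in> measurable M (sample_space U)"
      using indep that(1) by (auto simp: indep_vars_def)
    from measurable_space[OF this that(2)] show ?thesis
      by (simp add: sample_space_def space_pair_measure space_restrict_space)
  qed
  have g_measurable: "g x y \<in> borel_measurable D" for x y
  proof -
    have [measurable]: "(\<lambda>r. of_bool (r = z) :: real) \<in> borel_measurable (count_space U)" for z
      by simp
    have [measurable]: "(\<lambda>c. c) \<in> restrict_space borel {0<..<1} \<rightarrow>\<^sub>M (borel :: real measure)"
      by (rule measurable_restrict_space1) simp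
    show ?thesis
      unfolding measurable_cong_sets[OF sets_D refl] sample_space_def g_def ell_def by measurable
  qed
  \<comment> \<open>The difference of the two indicators is -1, 0 or 1, so the integrand is
    dominated by the absolute value of \<open>ell\<close>.\<close>
  have g_integrable: "integrable D (g x y)" for x y
    by (rule Bochner_Integration.integrable_bound[OF assms(5) g_measurable])
      (auto simp: g_def)
  have at_top: "AE \<omega> in M. filterlim (\<lambda>m. \<Sum>t=1..m. (of_bool (R t \<omega> = x) - of_bool (R t \<omega> = y)) * ell K (C t \<omega>)) at_top sequentially"
    if "(\<integral>z. g x y z \<partial>D) > 0" for x y
    using AE_iid_sum_at_top[OF indep law g_integrable that] by (simp add: g_def)
  \<comment> \<open>Here \<open>i\<close> is the losing candidate and \<open>j\<close> any candidate
    with positive mean log-score advantage over it.\<close>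
  have X_0: "AE \<omega> in M. (\<lambda>m. X i m \<omega>) \<longlonglongrightarrow> 0"
    if "i \<in> {1..K}" "j \<in> {1..K}" "i \<noteq> j" "(\<integral>z. g (a j) (a i) z \<partial>D) > 0" for i j
    using at_top[OF that(4)] AE_space
  proof eventually_elim
    case (elim \<omega>)
    have "a j \<noteq> a i"
      using assms(2) that by (auto dest: inj_onD)
    then show ?case
      unfolding X_def using C elim(2) that(2) elim(1) assms(1)
      by (intro normalized_score_tendsto_0[of K _ j]) auto
  qed
  have drift: "drift K a D k = (\<integral>z. g (a 1) (a k) z \<partial>D)" for k
    by (simp add: drift_def g_def)
  have g_swap: "(\<integral>z. g x y z \<partial>D) = - (\<integral>z. g y x z \<partial>D)" for x y
  proof -
    have "g x y = (\<lambda>z. - g y x z)"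
      by (auto simp: g_def fun_eq_iff of_bool_def)
    then show ?thesis
      by (simp only: integral_minus)
  qed
  show ?thesis
  proof (intro conjI impI)
    assume pos: "\<forall>k\<in>{1..K} - {1}. drift K a D k > 0"
    show k_0: "\<forall>k\<in>{1..K} - {1}. AE \<omega> in M. (\<lambda>m. X k m \<omega>) \<longlonglongrightarrow> 0"
    proof
      fix k assume "k \<in> {1..K} - {1}"
      with pos assms(1) show "AE \<omega> in M. (\<lambda>m. X k m \<omega>) \<longlonglongrightarrow> 0"
        by (intro X_0[of k 1]) (auto simp: drift)
    qed
    \<comment> \<open>Finitely many exceptional null sets are merged, so that all wrong candidates
      vanish along the same \<open>\<omega>\<close> and \<open>X 1\<close> keeps the remaining
      mass.\<close>
    then have "AE \<omega> in M. \<forall>k\<in>{1..K} - {1}. (\<lambda>m. X k m \<omega>) \<longlonglongrightarrow> 0"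
      by (intro AE_finite_allI) auto
    with AE_space show "AE \<omega> in M. (\<lambda>m. X 1 m \<omega>) \<longlonglongrightarrow> 1"
    proof eventually_elim
      case (elim \<omega>)
      have "X 1 m \<omega> = 1 - (\<Sum>k\<in>{1..K} - {1}. X k m \<omega>)" for m
        using sum_normalized_score[of K "\<lambda>t. C t \<omega>" a] C elim(1) assms(1)
        by (simp add: X_def sum_diff1)
      moreover have "(\<lambda>m. 1 - (\<Sum>k\<in>{1..K} - {1}. X k m \<omega>)) \<longlonglongrightarrow> 1 - (\<Sum>k\<in>{1..K} - {1}. 0)"
        using elim(2) by (intro tendsto_intros) auto
      ultimately show ?case by simp
    qed
  next
    assume "\<exists>k\<in>{1..K} - {1}. drift K a D k < 0"
    then obtain k where "k \<in> {1..K} - {1}" "drift K a D k < 0"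
      by blast
    \<comment> \<open>By antisymmetry a negative drift for \<open>k\<close> is a positive mean for
      \<open>a k\<close> against \<open>a 1\<close>.\<close>
    then show "AE \<omega> in M. (\<lambda>m. X 1 m \<omega>) \<longlonglongrightarrow> 0"
      using assms(1) g_swap[of "a 1" "a k"] by (intro X_0[of 1 k]) (auto simp: drift)
  qed
qed

end
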